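(* Let $(X,d,G)$ be a metric space with a graph and let $(A,B)$ be a $G$-Chebyshev pair of non-empty subsets of $X$. Suppose $\phi_1,\phi_2:[0,\infty)\to[0,\infty)$ are maps such that $\phi_1$ is increasing and $\phi_2-I$ is non-decreasing, and let $T:A\cup B\to A\cup B$ be a $G$-cyclic $(\phi_1,\phi_2)$-contraction. Suppose $x_0\in X_{T^2}^A$ and $x_{n+1}=Tx_n$ for $n\ge0$. If $A$ has property $( * )$ and $\{x_{2n}\}$ has a convergent subsequence in $A$, then $T$ has a best proximity point, i.e. there is a point $x\in A\cup B$ with $d(x,Tx)=d(A,B)$.
   Context: A metric space with a graph $(X,d,G)$ is a metric space $(X,d)$ together with a directed graph $G$ with vertex set $V(G)=X$ and edge set $E(G)\subseteq X\times X$ (no parallel edges) such that $(x,x)\in E(G)$ for all $x\in X$. For subsets $A,B$ of $X$, $d(A,B)=\inf\{d(a,b):a\in A,\ b\in B\}$. $I$ denotes the identity map on $[0,\infty)$; "increasing" means strictly increasing (as opposed to "non-decreasing"). The pair $(A,B)$ is $G$-Chebyshev if $\{(u,v)\in A\times B: d(u,v)=d(A,B)\}\subseteq E(G)$. A map $T:A\cup B\to A\cup B$ is cyclic if $T(A)\subseteq B$ and $T(B)\subseteq A$. For $(x,y)\in A\times B$ put $m(x,y)=\max\{d(x,Tx),d(y,Ty)\}$. Let $(A,B)$ be $G$-Chebyshev, $\phi_1:[0,\infty)\to[0,\infty)$ increasing and $\phi_2:[0,\infty)\to[0,\infty)$ with $\phi_2-I$ non-decreasing. A cyclic map $T$ on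 $A\cup B$ is a $G$-cyclic $(\phi_1,\phi_2)$-contraction if (i) $(T^2u,T^2v)\in E(G)$ for all $u,v\in A$ with $(u,v)\in E(G)$; and (ii) $d(Tx,Ty)\le (I-\phi_1)(d(x,y))+(I-\phi_2)(m(x,y))+(\phi_1+\phi_2-I)(d(A,B))$ for all $(x,y)\in A\times B$ with $\{(x,y),(x,Ty),(Ty,x)\}\cap E(G)\ne\emptyset$. $X_{T^2}^A=\{x\in A:(x,T^2x)\in E(G)\}$. $A$ has property $( * )$ if for any sequence $\{x_n\}$ in $A$ with $\lim_n x_n=x$ and $(x_n,x_{n+1})\in E(G)$ for all $n\in\mathbb{N}$, one has $(x_n,x)\in E(G)$ for all $n\in\mathbb{N}$. *)

theory Defs
  imports "HOL-Analysis.Analysis" "Graph_Theory.Pair_Digraph"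
begin

text \<open>
  The metric space \<open>X\<close> is the whole type, so the vertex set is \<open>UNIV\<close>.  A
  \<open>pair_pre_digraph\<close> has its arcs given as a set of ordered pairs, which
  excludes parallel edges.
\<close>
definition metric_space_graph :: "'a::metric_space pair_pre_digraph \<Rightarrow> bool" where
  "metric_space_graph G \<longleftrightarrow> pair_wf_digraph G \<and> pverts G = UNIV \<and> (\<forall>x. (x, x) \<in> parcs G)"

text \<open>
  For non-empty \<open>A\<close> and \<open>B\<close>, \<open>setdist A B\<close> is the infimum of the distances
  between their points; it is 0 by convention if one of them is empty.
\<close>
definition G_Chebyshev :: "'a::metric_space pair_pre_digraph \<Rightarrow> 'a set \<Rightarrow> 'a set \<Rightarrow> bool" where
  "G_Chebyshev G A B \<longleftrightarrow> {(u, v). u \<in> A \<and> v \<in> B \<and> dist u v = setdist A B} \<subseteq> parcs G"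

text \<open>
  A self-map of \<open>A \<union> B\<close> is a total function on the type; only its values on
  \<open>A \<union> B\<close> matter, here and below.
\<close>
definition cyclic_map :: "'a set \<Rightarrow> 'a set \<Rightarrow> ('a \<Rightarrow> 'a) \<Rightarrow> bool" where
  "cyclic_map A B T \<longleftrightarrow> T ` A \<subseteq> B \<and> T ` B \<subseteq> A"

definition max_displacement :: "('a::metric_space \<Rightarrow> 'a) \<Rightarrow> 'a \<Rightarrow> 'a \<Rightarrow> real" where
  "max_displacement T x y = max (dist x (T x)) (dist y (T y))"

text \<open>
  The functions \<open>\<phi>1\<close> and \<open>\<phi>2\<close> are only ever evaluated at non-negative arguments.
\<close>
definition G_cyclic_contraction ::
    "'a::metric_space pair_pre_digraph \<Rightarrow> 'a set \<Rightarrow> 'a set \<Rightarrow> (real \<Rightarrow> real) \<Rightarrow> (real \<Rightarrow> real)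
      \<Rightarrow> ('a \<Rightarrow> 'a) \<Rightarrow> bool" where
  "G_cyclic_contraction G A B \<phi>1 \<phi>2 T \<longleftrightarrow>
     cyclic_map A B T \<and>
     (\<forall>u\<in>A. \<forall>v\<in>A. (u, v) \<in> parcs G \<longrightarrow> (T (T u), T (T v)) \<in> parcs G) \<and>
     (\<forall>x\<in>A. \<forall>y\<in>B. {(x, y), (x, T y), (T y, x)} \<inter> parcs G \<noteq> {} \<longrightarrow>
        dist (T x) (T y) \<le>
          (dist x y - \<phi>1 (dist x y))
          + (max_displacement T x y - \<phi>2 (max_displacement T x y))
          + (\<phi>1 (setdist A B) + \<phi>2 (setdist A B) - setdist A B))"

definition XT2 :: "'a pair_pre_digraph \<Rightarrow> 'a set \<Rightarrow> ('a \<Rightarrow> 'a) \<Rightarrow> 'a set" where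
  "XT2 G A T = {x \<in> A. (x, T (T x)) \<in> parcs G}"

text \<open>
  The limit is allowed to be any point of the space, not only one of \<open>A\<close>.
\<close>
definition property_star :: "'a::metric_space pair_pre_digraph \<Rightarrow> 'a set \<Rightarrow> bool" where
  "property_star G A \<longleftrightarrow>
     (\<forall>s l. (\<forall>n::nat. s n \<in> A) \<and> s \<longlonglongrightarrow> l \<and> (\<forall>n. (s n, s (Suc n)) \<in> parcs G)
        \<longrightarrow> (\<forall>n. (s n, l) \<in> parcs G))"

definition best_proximity_point :: "'a::metric_space set \<Rightarrow> 'a set \<Rightarrow> ('a \<Rightarrow> 'a) \<Rightarrow> 'a \<Rightarrow> bool" where
  "best_proximity_point A B T x \<longleftrightarrow> x \<in> A \<union> B \<and> dist x (T x) = setdist A B"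

end

theory Submission
  imports Defs
begin

text \<open>
  Since \<open>\<phi>2 - I\<close> is non-decreasing and every displacement is at least \<open>D = d(A, B)\<close>, the
  \<open>\<phi>2\<close>-terms can be dropped from the contraction inequality, leaving
  \<open>d(Tx, Ty) \<le> d(x, y) - (\<phi>1 (d(x, y)) - \<phi>1 D)\<close>.  Along the orbit this makes the consecutive
  distances decrease to \<open>D\<close>.  Property \<open>(*)\<close> applied to eventually constant sequences shows that the
  edge relation is transitive on \<open>A\<close>, so the convergent subsequence of \<open>x\<^bsub>2n\<^esub>\<close> again has consecutive
  edges and each of its terms has an edge to the limit \<open>l\<close>.  Applying the contraction to \<open>l\<close> and the
  predecessors of the terms of the subsequence gives \<open>d(l, Tl) \<le> D\<close>.
\<close>

text \<open>Since \<phi> may jump at the limit \<open>L\<close>, the limit is not taken inside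
  \<phi>. Monotonicity bounds every drop \<open>d n - d (Suc n)\<close> below by the constant
  \<open>\<phi> L - \<phi> D\<close>; the drops tend to 0, so \<phi> L \<le> \<phi> D, and
  strictness excludes \<open>D < L\<close>.\<close>

lemma tendsto_of_strict_mono_decrease:
  fixes \<phi> :: "real \<Rightarrow> real" and d :: "nat \<Rightarrow> real"
  assumes mono: "strict_mono_on {0..} \<phi>" and "0 \<le> D"
    and lb: "\<And>n. D \<le> d n"
    and step: "\<And>n. d (Suc n) \<le> d n - (\<phi> (d n) - \<phi> D)"
  shows "d \<longlonglongrightarrow> D"
proof -
  have \<phi>_le: "\<phi> s \<le> \<phi> t" if "0 \<le> s" "s \<le> t" for s t
    using strict_mono_on_leD[OF mono] that by auto
  have "d (Suc n) \<le> d n" for n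
    using step[of n] \<phi>_le[OF \<open>0 \<le> D\<close> lb[of n]] by linarith
  then have "decseq d" by (rule decseq_SucI)
  then obtain L where lim: "d \<longlonglongrightarrow> L" and L: "\<And>n. L \<le> d n"
    using decseq_convergent[of d D] lb by auto
  have "D \<le> L" using lim lb by (intro LIMSEQ_le_const) auto
  have "(\<lambda>n. d n - d (Suc n)) \<longlonglongrightarrow> L - L"
    using lim LIMSEQ_Suc[OF lim] by (rule tendsto_diff)
  moreover have "\<phi> L - \<phi> D \<le> d n - d (Suc n)" for n
    using step[of n] \<phi>_le[OF _ L[of n]] \<open>0 \<le> D\<close> \<open>D \<le> L\<close> by linarith
  ultimately have "\<phi> L - \<phi> D \<le> L - L"
    by (intro LIMSEQ_le_const[where X = "\<lambda>n. d n - d (Suc n)"]) auto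
  moreover have "\<phi> D < \<phi> L" if "D < L"
    using strict_mono_onD[OF mono] that \<open>0 \<le> D\<close> by auto
  ultimately have "L = D" using \<open>D \<le> L\<close> by fastforce
  with lim show ?thesis by simp
qed

lemma property_star_trans:
  assumes "metric_space_graph G" "property_star G A"
    and "u \<in> A" "v \<in> A" "w \<in> A" "(u, v) \<in> parcs G" "(v, w) \<in> parcs G"
  shows "(u, w) \<in> parcs G"
proof -
  define s where "s n = (if n = 0 then u else if n = 1 then v else w)" for n :: nat
  have "eventually (\<lambda>n. s n = w) sequentially"
    unfolding eventually_sequentially by (rule exI[of _ 2]) (auto simp: s_def)
  then have "s \<longlonglongrightarrow> w" by (rule tendsto_eventually)
  \<comment> \<open>From index 2 on, the edge between successive terms is the loop at
    \<open>w\<close>.\<close>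
  moreover have "s n \<in> A" and "(s n, s (Suc n)) \<in> parcs G" for n
    using assms by (auto simp: s_def metric_space_graph_def)
  ultimately have "(s 0, w) \<in> parcs G"
    using assms(2) unfolding property_star_def by blast
  then show ?thesis by (simp add: s_def)
qed

lemma G_cyclic_contraction_dist_le:
  assumes contr: "G_cyclic_contraction G A B \<phi>1 \<phi>2 T"
    and mono: "mono_on {0..} (\<lambda>t. \<phi>2 t - t)"
    and "u \<in> A" "v \<in> B" "{(u, v), (u, T v), (T v, u)} \<inter> parcs G \<noteq> {}"
  shows "dist (T u) (T v) \<le> dist u v - (\<phi>1 (dist u v) - \<phi>1 (setdist A B))"
proof -
  let ?m = "max_displacement T u v"
  \<comment> \<open>The displacement of \<open>u\<close> is itself a distance from \<open>A\<close>
    to \<open>B\<close>, which already bounds the maximum below.\<close>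
  have "T u \<in> B" using contr \<open>u \<in> A\<close> by (auto simp: G_cyclic_contraction_def cyclic_map_def)
  then have "setdist A B \<le> ?m"
    using setdist_le_dist[OF \<open>u \<in> A\<close>] by (fastforce simp: max_displacement_def le_max_iff_disj)
  then have "\<phi>2 (setdist A B) - setdist A B \<le> \<phi>2 ?m - ?m"
    using mono_onD[OF mono, of "setdist A B" ?m] setdist_pos_le[of A B] by auto
  moreover have "dist (T u) (T v) \<le> (dist u v - \<phi>1 (dist u v)) + (?m - \<phi>2 ?m)
      + (\<phi>1 (setdist A B) + \<phi>2 (setdist A B) - setdist A B)"
    using contr assms(3-5) unfolding G_cyclic_contraction_def by blast
  ultimately show ?thesis by linarith
qed

theorem theorem3p2:
  fixes G :: "'a::metric_space pair_pre_digraph"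
    and A B :: "'a set"
    and \<phi>1 \<phi>2 :: "real \<Rightarrow> real"
    and T :: "'a \<Rightarrow> 'a"
    and x :: "nat \<Rightarrow> 'a"
  assumes "metric_space_graph G"
    and "A \<noteq> {}" and "B \<noteq> {}"
    and "G_Chebyshev G A B"
    and "\<phi>1 \<in> {0..} \<rightarrow> {0..}" and "\<phi>2 \<in> {0..} \<rightarrow> {0..}"
    and "strict_mono_on {0..} \<phi>1"
    and "mono_on {0..} (\<lambda>t. \<phi>2 t - t)"
    and "G_cyclic_contraction G A B \<phi>1 \<phi>2 T"
    and "x 0 \<in> XT2 G A T"
    and "\<And>n. x (Suc n) = T (x n)"
    and "property_star G A"
    and "\<exists>r l. strict_mono r \<and> l \<in> A \<and> ((\<lambda>n. x (2 * n)) \<circ> r) \<longlonglongrightarrow> l"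
  shows "\<exists>z. best_proximity_point A B T z"
proof -
  let ?D = "setdist A B"
  note contr_le = G_cyclic_contraction_dist_le[OF assms(9,8)]
  have TA: "T u \<in> B" if "u \<in> A" for u
    using assms(9) that by (auto simp: G_cyclic_contraction_def cyclic_map_def)
  have TB: "T v \<in> A" if "v \<in> B" for v
    using assms(9) that by (auto simp: G_cyclic_contraction_def cyclic_map_def)
  have loop: "(u, u) \<in> parcs G" for u
    using assms(1) by (simp add: metric_space_graph_def)
  have even_A: "x (2 * n) \<in> A" for n
    using assms(10) by (induction n) (auto simp: XT2_def assms(11) TA TB)
  have odd_B: "x (Suc (2 * n)) \<in> B" for n
    using TA[OF even_A] by (simp add: assms(11))
  have edge_Suc: "(x (2 * n), x (2 * Suc n)) \<in> parcs G" for n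
  proof (induction n)
    case 0
    then show ?case using assms(10) by (simp add: XT2_def assms(11) numeral_2_eq_2)
  next
    case (Suc n)
    then have "(T (T (x (2 * n))), T (T (x (2 * Suc n)))) \<in> parcs G"
      using assms(9) even_A unfolding G_cyclic_contraction_def by blast
    then show ?case by (simp add: assms(11))
  qed
  have edge: "(x (2 * m), x (2 * n)) \<in> parcs G" if "m \<le> n" for m n
    using that
  proof (induction n rule: dec_induct)
    case base
    then show ?case by (rule loop)
  next
    case (step n)
    then show ?case
      using property_star_trans[OF assms(1,12) even_A even_A even_A] edge_Suc by blast
  qed

  define d where "d n = dist (x n) (x (Suc n))" for n
  have d_step: "d (Suc n) \<le> d n - (\<phi>1 (d n) - \<phi>1 ?D)" for n
  proof (cases "even n")
    case True
    then obtain k where k: "n = 2 * k" by blast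
    \<comment> \<open>For the pair (x_2k, x_2k+1) the required edge is \<open>(u, T v)\<close>, that
      is (x_2k, x_2k+2).\<close>
    show ?thesis
      using contr_le[OF even_A[of k] odd_B[of k]] edge_Suc[of k]
      by (simp add: d_def k assms(11))
  next
    case False
    then obtain k where k: "n = Suc (2 * k)" using oddE by fastforce
    \<comment> \<open>Here the pair in A \<times> B is (x_2k+2, x_2k+1). Since
      \<open>T v = u\<close>, the required edge is a loop.\<close>
    show ?thesis
      using contr_le[OF even_A[of "Suc k"] odd_B[of k]] loop
      by (simp add: d_def k assms(11) dist_commute)
  qed
  have d_lb: "?D \<le> d n" for n
  proof (cases "even n")
    case True
    then obtain k where k: "n = 2 * k" by blast
    show ?thesis using setdist_le_dist[OF even_A[of k] odd_B[of k]] by (simp add: d_def k)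
  next
    case False
    then obtain k where k: "n = Suc (2 * k)" using oddE by fastforce
    show ?thesis
      using setdist_le_dist[OF even_A[of "Suc k"] odd_B[of k]] by (simp add: d_def k dist_commute)
  qed
  have d_lim: "d \<longlonglongrightarrow> ?D"
    by (rule tendsto_of_strict_mono_decrease[OF assms(7) setdist_pos_le]) (fact d_lb d_step)+

  obtain r l where r: "strict_mono r" and "l \<in> A"
    and lim: "(\<lambda>k. x (2 * r k)) \<longlonglongrightarrow> l"
    using assms(13) by (auto simp: o_def)
  have edge_l: "(x (2 * r k), l) \<in> parcs G" for k
  proof -
    \<comment> \<open>The subsequence may skip terms, so \<open>edge_Suc\<close> alone would not
      suffice.\<close>
    have "(x (2 * r k), x (2 * r (Suc k))) \<in> parcs G" for k
      using edge strict_mono_less_eq[OF r] by simp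
    then show ?thesis
      using assms(12)[unfolded property_star_def, rule_format, of "\<lambda>k. x (2 * r k)" l k]
        even_A lim by simp
  qed
  \<comment> \<open>The shift to \<open>Suc k\<close> makes the index positive, so that the term
    \<open>?z\<close> has a predecessor \<open>?y\<close> in \<open>B\<close>. As
    \<open>T ?y = ?z\<close>, the edge from \<open>?z\<close> to \<open>l\<close> is the third
    alternative \<open>(T v, u)\<close> of the contraction. The factor 2 comes from two triangle
    inequalities through \<open>?z\<close>.\<close>
  have bound: "dist l (T l) \<le> 2 * dist (x (2 * r (Suc k))) l + d (2 * r (Suc k) - 1)" for k
  proof -
    have "r (Suc k) \<noteq> 0"
      using strict_monoD[OF r, of k "Suc k"] by simp
    then obtain j where j: "r (Suc k) = Suc j" using not0_implies_Suc by blast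
    let ?y = "x (Suc (2 * j))" and ?z = "x (2 * Suc j)"
    have Ty: "T ?y = ?z" by (simp add: assms(11))
    have "dist (T l) ?z \<le> dist l ?y - (\<phi>1 (dist l ?y) - \<phi>1 ?D)"
      using contr_le[OF \<open>l \<in> A\<close> odd_B[of j]] edge_l[of "Suc k"] by (simp add: Ty j)
    moreover have "\<phi>1 ?D \<le> \<phi>1 (dist l ?y)"
      using strict_mono_on_leD[OF assms(7)] setdist_le_dist[OF \<open>l \<in> A\<close> odd_B[of j]]
        setdist_pos_le[of A B] by auto
    moreover have "dist l ?y \<le> dist ?z l + dist ?y ?z"
      using dist_triangle[of l ?y ?z] by (simp add: dist_commute)
    moreover have "dist l (T l) \<le> dist ?z l + dist (T l) ?z"
      using dist_triangle[of l "T l" ?z] by (simp add: dist_commute)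
    ultimately have "dist l (T l) \<le> 2 * dist ?z l + dist ?y ?z" by linarith
    then show ?thesis by (simp add: j d_def)
  qed
  \<comment> \<open>The odd indices of the predecessors tend to infinity, so the limit of
    \<open>d\<close> applies along them.\<close>
  have "filterlim (\<lambda>k. 2 * r (Suc k) - 1) at_top sequentially"
  proof (rule filterlim_at_top_mono[OF filterlim_ident])
    have "k \<le> 2 * r (Suc k) - 1" for k
      using strict_mono_imp_increasing[OF r, of "Suc k"] by linarith
    then show "\<forall>\<^sub>F k in sequentially. k \<le> 2 * r (Suc k) - 1" by simp
  qed
  then have "(\<lambda>k. d (2 * r (Suc k) - 1)) \<longlonglongrightarrow> ?D"
    using d_lim by (rule filterlim_compose[rotated])
  moreover have "(\<lambda>k. dist (x (2 * r (Suc k))) l) \<longlonglongrightarrow> 0"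
    by (rule tendsto_dist_iff[THEN iffD1, OF LIMSEQ_Suc[OF lim]])
  ultimately have "(\<lambda>k. 2 * dist (x (2 * r (Suc k))) l + d (2 * r (Suc k) - 1)) \<longlonglongrightarrow> 2 * 0 + ?D"
    by (intro tendsto_intros)
  then have "dist l (T l) \<le> 2 * 0 + ?D"
    using bound by (intro LIMSEQ_le_const) auto
  moreover have "?D \<le> dist l (T l)"
    using setdist_le_dist[OF \<open>l \<in> A\<close> TA[OF \<open>l \<in> A\<close>]] .
  ultimately have "best_proximity_point A B T l"
    using \<open>l \<in> A\<close> by (simp add: best_proximity_point_def)
  then show ?thesis ..
qed

end
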